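(* For every integer $k \geq 2$ and every nonzero complex number $z$, the following identity of formal power series in $q$ holds: \[ \sum_{n = 1}^\infty \left(\sum_{\substack{\pi \in \mathcal{D} (n) \\ \#(\pi) \geq k}} (-1)^{\# (\pi)} \left(1 + z + z^2 + \cdots + z^{s_k (\pi) - s_{k - 1} (\pi) - 1}\right)\right) q^n = (-1)^{k - 1} \frac{q^{(k - 1)(k - 2)/2}}{z} \sum_{m = k - 1}^\infty \left(\frac{q}{z}\right)^m \begin{bmatrix} m-1 \\ k-2\end{bmatrix}_q \sum_{n = m + 1}^\infty z^n \big((q^n; q)_\infty - 1\big). \]
   Context: For a positive integer $n$, $\mathcal{D}(n)$ denotes the set of partitions of $n$ into distinct parts; for $\pi \in \mathcal{D}(n)$, $\#(\pi)$ is the number of parts of $\pi$ and $s_j(\pi)$ is the $j$th smallest part of $\pi$ (for $j\ge1$). Here $(a;q)_\infty=\prod_{i\ge0}(1-aq^i)$, $(q;q)_n=(1-q)\cdots(1-q^n)$, and $\begin{bmatrix} n \\ r\end{bmatrix}_q = \frac{(q;q)_n}{(q;q)_r (q;q)_{n-r}}$ for $n\ge r\ge 0$ and $0$ for $n<r$. *)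

theory Defs
  imports "HOL-Analysis.Infinite_Products" "HOL-Computational_Algebra.Formal_Power_Series"
begin

unbundle no vec_syntax and fps_syntax

definition distinct_partitions :: "nat \<Rightarrow> nat set set" where
  "distinct_partitions n = {\<pi>. finite \<pi> \<and> 0 \<notin> \<pi> \<and> \<Sum>\<pi> = n}"

(* Parts are counted from j = 1; the value is only meaningful for 1 \<le> j \<le> card \<pi>. *)
definition smallest_part :: "nat \<Rightarrow> nat set \<Rightarrow> nat" where
  "smallest_part j \<pi> = sorted_list_of_set \<pi> ! (j - 1)"

(* The variable q is fps_X.  Limits, infinite sums and infinite products of formal power
   series refer to the library's metric on fps, i.e. to coefficientwise stabilisation
   (tendsto_fps_iff). *)

definition qpoch_inf :: "complex fps \<Rightarrow> complex fps" where
  "qpoch_inf a = (\<Prod>i. 1 - a * fps_X ^ i)"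

definition qfact :: "nat \<Rightarrow> complex fps" where
  "qfact n = (\<Prod>i=1..n. 1 - fps_X ^ i)"

definition qbinom :: "nat \<Rightarrow> nat \<Rightarrow> complex fps" where
  "qbinom n r = (if r \<le> n then qfact n / (qfact r * qfact (n - r)) else 0)"

lemma finite_distinct_partitions: "finite (distinct_partitions n)"
proof (rule finite_subset)
  show "distinct_partitions n \<subseteq> Pow {..n}"
    proof (intro subsetI PowI)
    fix \<pi> x
    assume "\<pi> \<in> distinct_partitions n" "x \<in> \<pi>"
    then show "x \<in> {..n}"
      using member_le_sum[of x \<pi> "\<lambda>x. x"] by (auto simp: distinct_partitions_def)
  qed
qed simp

(* The denominator of qbinom is a unit, so the division there is a genuine one. *)
lemma qfact_nth_0: "qfact n $ 0 = 1"
proof (induction n)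
  case (Suc n)
  have "qfact (Suc n) = qfact n * (1 - fps_X ^ Suc n)"
    by (simp add: qfact_def)
  with Suc show ?case
    by simp
qed (simp add: qfact_def)

(* All infinite sums and products used in the theorem converge: qpoch_inf_has_prod,
   summable_inner, summable_outer. *)

lemma fps_LIMSEQ_stable:
  fixes g :: "nat \<Rightarrow> complex fps"
  assumes "\<And>m j. j \<le> m \<Longrightarrow> g (Suc m) $ j = g m $ j"
  shows "g \<longlonglongrightarrow> Abs_fps (\<lambda>j. g j $ j)"
proof (rule tendsto_fpsI)
  fix j
  have "g m $ j = g j $ j" if "m \<ge> j" for m
    using that
  proof (induction m rule: dec_induct)
    case (step i)
    then show ?case using assms[of j i] by simp
  qed simp
  then show "\<forall>\<^sub>F m in sequentially. g m $ j = Abs_fps (\<lambda>j. g j $ j) $ j"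
    unfolding fps_nth_Abs_fps by (intro eventually_sequentiallyI[of j])
qed

lemma fps_summableI:
  fixes f :: "nat \<Rightarrow> complex fps"
  assumes "\<And>i j. j < i \<Longrightarrow> f i $ j = 0"
  shows "summable f"
proof -
  have "(\<lambda>m. \<Sum>i\<le>m. f i) \<longlonglongrightarrow> Abs_fps (\<lambda>j. (\<Sum>i\<le>j. f i) $ j)"
    by (rule fps_LIMSEQ_stable) (simp add: assms)
  then show ?thesis
    by (auto simp: summable_def sums_def_le)
qed

lemma fps_X_power_nth_low: "j < m \<Longrightarrow> (h * fps_X ^ m) $ j = (0 :: complex)"
  by (simp add: fps_X_power_mult_right_nth)

lemma partial_qpoch_nth:
  assumes "n \<ge> 1" "j < n"
  shows "(\<Prod>i\<le>m. 1 - fps_X ^ n * fps_X ^ i :: complex fps) $ j = 1 $ j"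
proof (induction m)
  case 0
  then show ?case using assms by simp
next
  case (Suc m)
  have "(\<Prod>i\<le>Suc m. 1 - fps_X ^ n * fps_X ^ i :: complex fps) =
      (\<Prod>i\<le>m. 1 - fps_X ^ n * fps_X ^ i) -
      (\<Prod>i\<le>m. 1 - fps_X ^ n * fps_X ^ i) * fps_X ^ (n + Suc m)"
    by (simp only: prod.atMost_Suc power_add right_diff_distrib mult_1_right mult.assoc)
  with Suc assms show ?case
    by (simp only: fps_sub_nth fps_X_power_nth_low) simp
qed

lemma qpoch_inf_has_prod:
  assumes "n \<ge> 1"
  shows "(\<lambda>i. 1 - fps_X ^ n * fps_X ^ i) has_prod qpoch_inf (fps_X ^ n)"
proof -
  let ?P = "\<lambda>m. \<Prod>i\<le>m. 1 - fps_X ^ n * fps_X ^ i :: complex fps"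
  let ?L = "Abs_fps (\<lambda>j. ?P j $ j)"
  have eq: "?P (Suc m) = ?P m - ?P m * fps_X ^ (n + Suc m)" for m
    by (simp only: prod.atMost_Suc power_add right_diff_distrib mult_1_right mult.assoc)
  have "?P (Suc m) $ j = ?P m $ j" if "j \<le> m" for m j
    using that by (simp only: eq fps_sub_nth fps_X_power_nth_low) simp
  then have "?P \<longlonglongrightarrow> ?L"
    by (rule fps_LIMSEQ_stable)
  moreover have "?L $ 0 = 1"
    using assms partial_qpoch_nth[of n 0 0] by simp
  then have "?L \<noteq> 0"
    by (metis fps_zero_nth zero_neq_one)
  ultimately have "(\<lambda>i. 1 - fps_X ^ n * fps_X ^ i :: complex fps) has_prod ?L"
    by (simp add: has_prod_def raw_has_prod_def)
  then show ?thesis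
    unfolding qpoch_inf_def by (simp only: has_prod_unique[symmetric])
qed

lemma qpoch_inf_nth:
  assumes "n \<ge> 1" "j < n"
  shows "qpoch_inf (fps_X ^ n) $ j = 1 $ j"
proof -
  have "(\<lambda>m. \<Prod>i\<le>m. 1 - fps_X ^ n * fps_X ^ i :: complex fps) \<longlonglongrightarrow> qpoch_inf (fps_X ^ n)"
  proof -
    have "1 - fps_X ^ n * fps_X ^ i \<noteq> (0 :: complex fps)" for i
    proof
      assume "1 - fps_X ^ n * fps_X ^ i = (0 :: complex fps)"
      then have "(1 - fps_X ^ n * fps_X ^ i) $ 0 = (0 :: complex)" by simp
      then show False using assms(1) by simp
    qed
    with qpoch_inf_has_prod[OF assms(1)] show ?thesis
      by (auto simp: has_prod_def raw_has_prod_def)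
  qed
  then have "\<forall>\<^sub>F m in sequentially.
      (\<Prod>i\<le>m. 1 - fps_X ^ n * fps_X ^ i :: complex fps) $ j = qpoch_inf (fps_X ^ n) $ j"
    by (simp add: tendsto_fps_iff)
  then show ?thesis
    unfolding partial_qpoch_nth[OF assms] by (auto simp: eventually_at_top_linorder)
qed

lemma summable_inner:
  "summable (\<lambda>i. let n = i + (m + 1) in fps_const (z ^ n) * (qpoch_inf (fps_X ^ n) - 1))"
proof (rule fps_summableI)
  fix i j :: nat
  assume "j < i"
  then have "qpoch_inf (fps_X ^ (i + (m + 1))) $ j = 1 $ j"
    by (intro qpoch_inf_nth) simp_all
  then show "(let n = i + (m + 1) in fps_const (z ^ n) * (qpoch_inf (fps_X ^ n) - 1)) $ j = 0"
    by (simp only: Let_def fps_mult_left_const_nth fps_sub_nth diff_self mult_zero_right)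
qed

lemma summable_outer:
  "summable (\<lambda>i. let m = i + (k - 1) in (fps_const (1 / z) * fps_X) ^ m * F m :: complex fps)"
proof (rule fps_summableI)
  fix i j :: nat
  assume "j < i"
  have "(fps_const (1 / z) * fps_X) ^ m * F m = fps_const (1 / z) ^ m * F m * fps_X ^ m" for m
    by (simp add: power_mult_distrib mult_ac)
  with \<open>j < i\<close> show "(let m = i + (k - 1) in (fps_const (1 / z) * fps_X) ^ m * F m) $ j = 0"
    by (simp only: Let_def fps_X_power_nth_low)
qed

end

theory Submission
  imports Defs
begin

text \<open>
  A partition with at least \<open>k\<close> distinct parts splits uniquely at its part \<open>m = s\<^sub>k\<^sub>-\<^sub>1\<close> into the
  \<open>k - 2\<close> parts below \<open>m\<close>, the part \<open>m\<close> and a nonempty set \<open>B\<close> of parts above \<open>m\<close>, with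
  \<open>s\<^sub>k = Min B\<close>.  The lower parts are counted by \<open>q\<close> to the power \<open>(k - 1)(k - 2)/2\<close> times the
  \<open>q\<close>-binomial coefficient of \<open>m - 1\<close> over \<open>k - 2\<close>.  The weight of \<open>B\<close> is \<open>z\<close> to the power
  \<open>-m-1\<close> times the sum of \<open>z\<^sup>n\<close> over \<open>m < n \<le> Min B\<close>, and for fixed \<open>n\<close> the nonempty \<open>B\<close> with
  \<open>n \<le> Min B\<close> have signed generating function \<open>(q\<^sup>n; q)\<^sub>\<infinity> - 1\<close>.  The coefficient of \<open>q\<^sup>N\<close> only
  involves parts up to \<open>N\<close>, so all infinite sums and products can be truncated there.
\<close>

section \<open>Coefficientwise truncation of infinite sums and products\<close>

text \<open>Terms with index above \<open>j\<close> do not reach degree \<open>j\<close>, so the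
  partial sums are constant there from \<open>j\<close> on. Allowing any cut-off \<open>n\<close>
  with \<open>j \<le> n\<close> lets one bound serve many degrees.\<close>

lemma fps_suminf_nth:
  fixes f :: "nat \<Rightarrow> complex fps"
  assumes "\<And>i j. j < i \<Longrightarrow> f i $ j = 0" and "j \<le> n"
  shows "suminf f $ j = (\<Sum>i\<le>n. f i $ j)"
proof -
  have "(\<lambda>m. \<Sum>i\<le>m. f i) \<longlonglongrightarrow> suminf f"
    by (intro summable_LIMSEQ' fps_summableI assms(1))
  then have "\<forall>\<^sub>F m in sequentially. (\<Sum>i\<le>m. f i) $ j = suminf f $ j"
    by (simp add: tendsto_fps_iff)
  then obtain m where "m \<ge> n" and m: "(\<Sum>i\<le>m. f i) $ j = suminf f $ j"
    unfolding eventually_at_top_linorder by (meson nle_le)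
  have "(\<Sum>i\<le>m. f i $ j) = (\<Sum>i\<le>n. f i $ j)"
    using \<open>m \<ge> n\<close> assms by (intro sum.mono_neutral_right) auto
  with m show ?thesis
    by (simp add: fps_sum_nth)
qed

lemma fps_mult_nth_cong:
  fixes f g h :: "'a :: comm_ring_1 fps"
  assumes "\<And>i. i \<le> n \<Longrightarrow> f $ i = g $ i"
  shows "(h * f) $ n = (h * g) $ n"
  by (simp add: fps_mult_nth assms)

text \<open>Factors with \<open>i > N\<close> change only degrees above \<open>N\<close>. For
  \<open>n > N\<close> the finite product is empty, and the infinite one agrees with 1 in the
  degrees considered.\<close>

lemma qpoch_inf_nth_eq_prod:
  assumes "n \<ge> 1" "j \<le> N"
  shows "qpoch_inf (fps_X ^ n) $ j = (\<Prod>i=n..N. 1 - fps_X ^ i) $ j"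
proof -
  let ?P = "\<lambda>M. \<Prod>i=n..M. 1 - fps_X ^ i :: complex fps"
  have eq: "(\<Prod>i\<le>m. 1 - fps_X ^ n * fps_X ^ i) = ?P (n + m)" for m
    by (induction m) (simp_all add: power_add)
  \<comment> \<open>\<open>has_prod\<close> permits skipping an initial segment that ends in a zero
    factor. As no factor vanishes, the partial products themselves converge to the value.\<close>
  have nz: "1 - fps_X ^ n * fps_X ^ i \<noteq> (0 :: complex fps)" for i
  proof
    assume "1 - fps_X ^ n * fps_X ^ i = (0 :: complex fps)"
    then have "(1 - fps_X ^ n * fps_X ^ i) $ 0 = (0 :: complex)"
      by simp
    then show False
      using assms(1) by simp
  qed
  have "(\<lambda>m. ?P (n + m)) \<longlonglongrightarrow> qpoch_inf (fps_X ^ n)"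
    using qpoch_inf_has_prod[OF assms(1)] nz unfolding eq[symmetric]
    by (auto simp: has_prod_def raw_has_prod_def)
  then have "\<forall>\<^sub>F m in sequentially. ?P (n + m) $ j = qpoch_inf (fps_X ^ n) $ j"
    by (simp add: tendsto_fps_iff)
  then obtain m where "m \<ge> N" and m: "?P (n + m) $ j = qpoch_inf (fps_X ^ n) $ j"
    unfolding eventually_at_top_linorder by (meson nle_le)
  have "?P M $ j = ?P N $ j" if "M \<ge> N" for M
    using that
  proof (induction M rule: dec_induct)
    case (step M)
    show ?case
    \<comment> \<open>Splitting off the top factor requires \<open>{n..Suc M}\<close> to be
      nonempty; otherwise both products are empty.\<close>
    proof (cases "n \<le> Suc M")
      case True
      then have "?P (Suc M) = ?P M - ?P M * fps_X ^ Suc M"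
        by (simp only: prod.nat_ivl_Suc' left_diff_distrib mult_1_left mult.commute)
      moreover have "(?P M * fps_X ^ Suc M) $ j = 0"
        using step assms(2) by (intro fps_X_power_nth_low) simp
      ultimately show ?thesis
        using step by (simp only: fps_sub_nth) simp
    next
      case False
      with step show ?thesis
        by simp
    qed
  qed simp
  then show ?thesis
    using m \<open>m \<ge> N\<close> by (metis trans_le_add2)
qed

section \<open>Generating functions of subsets and Gaussian binomial coefficients\<close>

text \<open>Multiplying out, \<open>B\<close> collects the indices whose factor contributes
  \<open>- x ^ i\<close>.\<close>

lemma prod_one_minus_power:
  fixes x :: "'a :: comm_ring_1"
  assumes "finite A"
  shows "(\<Prod>i\<in>A. 1 - x ^ i) = (\<Sum>B\<in>Pow A. (- 1) ^ card B * x ^ \<Sum>B)"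
  using assms by (simp add: prod_diff_conv_sum power_sum)

lemma qfact_0: "qfact 0 = 1"
  by (simp add: qfact_def)

lemma qfact_Suc: "qfact (Suc n) = (1 - fps_X ^ Suc n) * qfact n"
  by (simp add: qfact_def mult.commute)

lemma qfact_nonzero [simp]: "qfact n \<noteq> 0"
  using qfact_nth_0[of n] by (metis fps_zero_nth zero_neq_one)

text \<open>The denominator has constant term 1 and is a unit, so the division is exact. Identities
  between Gaussian binomials can thus be checked after clearing denominators.\<close>

lemma qbinom_mult:
  assumes "r \<le> n"
  shows "qbinom n r * (qfact r * qfact (n - r)) = qfact n"
proof -
  have "is_unit (qfact r * qfact (n - r))"
    by (simp add: qfact_nth_0)
  with assms show ?thesis
    by (simp add: qbinom_def dvd_div_mult_self unit_imp_dvd)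
qed

lemma qbinom_0: "qbinom n 0 = 1"
  using qbinom_mult[of 0 n] by (simp add: qfact_0)

lemma qbinom_self: "qbinom n n = 1"
  using qbinom_mult[of n n] by (simp add: qfact_0)

text \<open>Of the two q-Pascal rules, this one matches splitting subsets by their largest possible
  element. For \<open>r > n\<close> the truncated exponent is harmless because
  \<open>qbinom n r\<close> is 0.\<close>

lemma qbinom_Suc_Suc:
  "qbinom (Suc n) (Suc r) = qbinom n (Suc r) + fps_X ^ (n - r) * qbinom n r"
proof (cases "r < n")
  case True
  then obtain d where d: "n - r = Suc d" "n - Suc r = d"
    by (metis Suc_diff_Suc)
  have n: "n = Suc (r + d)"
    using d True by simp
  \<comment> \<open>A common denominator of all three Gaussian binomials. Over it the claim becomes
    \<open>(1 - x) + x * (1 - y) = 1 - x * y\<close> with \<open>x = fps_X ^ Suc d\<close> and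
    \<open>y = fps_X ^ Suc r\<close>.\<close>
  define D where "D = qfact (Suc r) * qfact (Suc d)"
  have 1: "qbinom n (Suc r) * D = qfact n * (1 - fps_X ^ Suc d)"
    using qbinom_mult[of "Suc r" n] True d by (simp add: D_def qfact_Suc[of d] algebra_simps)
  have 2: "qbinom n r * D = qfact n * (1 - fps_X ^ Suc r)"
    using qbinom_mult[of r n] True d by (simp add: D_def qfact_Suc[of r] algebra_simps)
  have "Suc n = Suc d + Suc r"
    using n by simp
  then have 3: "qbinom (Suc n) (Suc r) * D = qfact n * (1 - fps_X ^ Suc d * fps_X ^ Suc r)"
    using qbinom_mult[of "Suc r" "Suc n"] True d qfact_Suc[of n]
    by (metis D_def Suc_le_mono diff_Suc_Suc mult.commute order_less_imp_le power_add)
  have "(qbinom n (Suc r) + fps_X ^ (n - r) * qbinom n r) * D = qbinom (Suc n) (Suc r) * D"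
    unfolding distrib_right mult.assoc 1 2 3 d by (simp add: right_diff_distrib mult.left_commute)
  moreover have "D \<noteq> 0"
    by (simp add: D_def)
  ultimately show ?thesis
    by simp
next
  case False
  then show ?thesis
    by (cases "r = n") (simp_all add: qbinom_self, simp_all add: qbinom_def)
qed

text \<open>A subset of \<open>{1..Suc n}\<close> either avoids \<open>Suc n\<close> or arises by
  inserting it into a smaller subset, which mirrors \<open>qbinom_Suc_Suc\<close>. The leading
  exponent is the least possible sum, \<open>1 + ... + r\<close>.\<close>

lemma sum_power_subsets:
  "(\<Sum>A | A \<subseteq> {1..n} \<and> card A = r. fps_X ^ \<Sum>A) = fps_X ^ (r * (r + 1) div 2) * qbinom n r"
proof (induction n arbitrary: r)
  case 0
  have "{A. A \<subseteq> {1..0::nat} \<and> card A = r} = (if r = 0 then {{}} else {})"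
    by auto
  then show ?case
    by (simp add: qbinom_def qfact_def)
next
  case (Suc n)
  let ?S = "\<lambda>n r. {A. A \<subseteq> {1..n} \<and> card A = r}"
  show ?case
  proof (cases r)
    case 0
    have "?S (Suc n) 0 = {{}}"
      using finite_subset by fastforce
    with 0 show ?thesis
      by (simp add: qbinom_0)
  next
    case r: (Suc r')
    have fin: "finite A \<and> Suc n \<notin> A" if "A \<subseteq> {1..n}" for A
      using that finite_subset by auto
    have split: "?S (Suc n) (Suc r') = ?S n (Suc r') \<union> insert (Suc n) ` ?S n r'" (is "?L = ?R")
    proof (intro equalityI subsetI)
      fix A assume A: "A \<in> ?L"
      then have "finite A"
        using finite_subset by auto
      show "A \<in> ?R"
      proof (cases "Suc n \<in> A")
        case True
        have "A - {Suc n} \<in> ?S n r'"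
          using A True \<open>finite A\<close> by (auto simp: le_Suc_eq)
        moreover have "A = insert (Suc n) (A - {Suc n})"
          using True by auto
        ultimately show ?thesis
          by blast
      next
        case False
        with A show ?thesis
          by (force simp: le_Suc_eq subset_iff)
      qed
    next
      fix A assume "A \<in> ?R"
      then show "A \<in> ?L"
        using fin by (auto simp: card_insert_if)
    qed
    have inj: "inj_on (insert (Suc n)) (?S n r')"
      using fin by (intro inj_onI) (metis (no_types, lifting) insert_ident mem_Collect_eq)
    have disj: "?S n (Suc r') \<inter> insert (Suc n) ` ?S n r' = {}"
      using fin by auto
    have "(\<Sum>A\<in>insert (Suc n) ` ?S n r'. fps_X ^ \<Sum>A)
        = (\<Sum>A\<in>?S n r'. fps_X ^ Suc n * fps_X ^ \<Sum>A :: complex fps)"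
      unfolding sum.reindex[OF inj] o_def using fin
      by (intro sum.cong) (simp_all add: power_add)
    also have "\<dots> = fps_X ^ (Suc n + r' * (r' + 1) div 2) * qbinom n r'"
      unfolding sum_distrib_left[symmetric] Suc by (simp add: power_add mult_ac)
    also have "\<dots> = fps_X ^ (r * (r + 1) div 2) * (fps_X ^ (n - r') * qbinom n r')"
    \<comment> \<open>The exponents balance only if \<open>n - r'\<close> is a true difference;
      otherwise both sides contain the factor \<open>qbinom n r' = 0\<close>.\<close>
    proof (cases "r' \<le> n")
      case True
      then have "Suc n + r' * (r' + 1) div 2 = r * (r + 1) div 2 + (n - r')"
        using r by (auto simp: algebra_simps)
      then show ?thesis
        by (simp only: power_add mult.assoc)
    qed (simp add: qbinom_def)
    finally have 2: "(\<Sum>A\<in>insert (Suc n) ` ?S n r'. fps_X ^ \<Sum>A)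
      = fps_X ^ (r * (r + 1) div 2) * (fps_X ^ (n - r') * qbinom n r')" .
    have "(\<Sum>A\<in>?S (Suc n) r. fps_X ^ \<Sum>A)
        = (\<Sum>A\<in>?S n (Suc r'). fps_X ^ \<Sum>A) + (\<Sum>A\<in>insert (Suc n) ` ?S n r'. fps_X ^ \<Sum>A :: complex fps)"
      unfolding r split by (intro sum.union_disjoint disj) (auto intro: finite_subset[of _ "Pow {1..n}"])
    then show ?thesis
      unfolding 2 Suc r qbinom_Suc_Suc by (simp add: distrib_left)
  qed
qed

section \<open>The \<open>j\<close>th smallest part and splitting a partition at a part\<close>

text \<open>Replaces the sorted list by a count of smaller elements, which is easier to handle for
  unions.\<close>

lemma smallest_part_props:
  assumes "finite \<pi>" "1 \<le> j" "j \<le> card \<pi>"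
  shows "smallest_part j \<pi> \<in> \<pi>" and "card {x \<in> \<pi>. x < smallest_part j \<pi>} = j - 1"
proof -
  define xs where "xs = sorted_list_of_set \<pi>"
  have xs: "sorted_wrt (<) xs" "set xs = \<pi>" "length xs = card \<pi>"
    using assms(1) by (auto simp: xs_def)
  have lt: "j - 1 < length xs"
    using assms xs by simp
  show "smallest_part j \<pi> \<in> \<pi>"
    using lt xs unfolding smallest_part_def xs_def[symmetric] by auto
  have less_iff: "xs ! a < xs ! b \<longleftrightarrow> a < b" if "a < length xs" "b < length xs" for a b
    using that xs(1) by (metis linorder_neqE_nat not_less_iff_gr_or_eq sorted_wrt_nth_less)
  have "{x \<in> \<pi>. x < xs ! (j - 1)} = (!) xs ` {..<j - 1}"
    using lt unfolding xs(2)[symmetric]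
    by (auto simp: in_set_conv_nth less_iff) (use order.strict_trans in blast)
  moreover have "inj_on ((!) xs) {..<j - 1}"
    using lt less_iff by (intro linorder_inj_onI) (auto simp: order_less_imp_not_eq)
  ultimately show "card {x \<in> \<pi>. x < smallest_part j \<pi>} = j - 1"
    unfolding smallest_part_def xs_def[symmetric] by (simp add: card_image)
qed

text \<open>The number of smaller elements increases strictly along the set, so it determines the
  element.\<close>

lemma smallest_part_eqI:
  assumes "finite \<pi>" "x \<in> \<pi>" "Suc (card {y \<in> \<pi>. y < x}) = j"
  shows "smallest_part j \<pi> = x"
proof -
  have "card {y \<in> \<pi>. y < x} < card \<pi>"
    using assms by (intro psubset_card_mono) auto
  then have j: "1 \<le> j" "j \<le> card \<pi>"
    using assms(3) by auto
  let ?s = "smallest_part j \<pi>"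
  note s = smallest_part_props[OF assms(1) j]
  have eq: "card {y \<in> \<pi>. y < ?s} = card {y \<in> \<pi>. y < x}"
    using s assms(3) by simp
  have mono: "card {y \<in> \<pi>. y < a} < card {y \<in> \<pi>. y < b}" if "a < b" "a \<in> \<pi>" for a b
    using that assms(1) by (intro psubset_card_mono) auto
  show ?thesis
    using mono[of ?s x] mono[of x ?s] s assms(2) eq by (metis less_irrefl linorder_neqE_nat)
qed

text \<open>With \<open>A\<close> below and \<open>B\<close> above the pivot \<open>m\<close>,
  exactly \<open>card A\<close> elements precede \<open>m\<close> and one more precedes
  \<open>Min B\<close>. For \<open>card A = k - 2\<close> these are the parts in positions
  \<open>k - 1\<close> and \<open>k\<close>.\<close>

lemma
  fixes A B :: "nat set"
  assumes "finite A" "finite B" "\<And>x. x \<in> A \<Longrightarrow> x < m" "\<And>x. x \<in> B \<Longrightarrow> m < x"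
  shows card_Un_insert_pivot: "card (A \<union> insert m B) = Suc (card A + card B)"
    and sum_Un_insert_pivot: "\<Sum>(A \<union> insert m B) = \<Sum>A + m + \<Sum>B"
    and smallest_part_pivot: "smallest_part (Suc (card A)) (A \<union> insert m B) = m"
    and smallest_part_after_pivot:
      "B \<noteq> {} \<Longrightarrow> smallest_part (Suc (Suc (card A))) (A \<union> insert m B) = Min B"
proof -
  have disj: "A \<inter> insert m B = {}" "m \<notin> B"
    using assms(3,4) by fastforce+
  show "card (A \<union> insert m B) = Suc (card A + card B)"
    using assms(1,2) disj by (simp add: card_Un_disjoint)
  show "\<Sum>(A \<union> insert m B) = \<Sum>A + m + \<Sum>B"
    using assms(1,2) disj by (simp add: sum.union_disjoint)
  have "{x \<in> A \<union> insert m B. x < m} = A"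
    using assms(3,4) by fastforce
  then show "smallest_part (Suc (card A)) (A \<union> insert m B) = m"
    using assms(1,2) by (intro smallest_part_eqI) auto
  assume "B \<noteq> {}"
  then have Min: "Min B \<in> B" "\<And>x. x \<in> B \<Longrightarrow> Min B \<le> x"
    using assms(2) by auto
  then have "{x \<in> A \<union> insert m B. x < Min B} = insert m A"
    using assms(3,4) by fastforce
  moreover have "card (insert m A) = Suc (card A)"
    using assms(1) disj by simp
  ultimately show "smallest_part (Suc (Suc (card A))) (A \<union> insert m B) = Min B"
    using assms(1,2) Min by (intro smallest_part_eqI) auto
qed

text \<open>Cutting at the part in position \<open>k - 1\<close> is inverse to gluing
  \<open>A\<close>, \<open>m\<close> and \<open>B\<close>; having at least \<open>k\<close> parts
  means that \<open>B\<close> is nonempty. Any \<open>M \<ge> N\<close> may bound \<open>m\<close>,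
  since no nonempty \<open>B\<close> exists once \<open>m \<ge> N\<close>.\<close>

lemma sum_subsets_by_smallest_part:
  fixes f :: "nat set \<Rightarrow> 'a :: comm_monoid_add"
  assumes "k \<ge> 2" "N \<le> M"
  shows "(\<Sum>\<pi> | \<pi> \<subseteq> {1..N} \<and> k \<le> card \<pi>. f \<pi>) =
    (\<Sum>m=k-1..M. \<Sum>A | A \<subseteq> {1..m-1} \<and> card A = k - 2. \<Sum>B | B \<subseteq> {m+1..N} \<and> B \<noteq> {}.
       f (A \<union> insert m B))" (is "?lhs = (\<Sum>m=_.._. sum (\<lambda>A. sum _ (?Bs m)) (?As m))")
proof -
  have finA: "finite (?As m)" for m
    by (rule finite_subset[of _ "Pow {1..m-1}"]) auto
  have finB: "finite (?Bs m)" for m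
    by (rule finite_subset[of _ "Pow {m+1..N}"]) auto
  let ?T = "Sigma {k-1..M} (\<lambda>m. ?As m \<times> ?Bs m)"
  let ?P = "{\<pi>. \<pi> \<subseteq> {1..N} \<and> k \<le> card \<pi>}"
  let ?m = "\<lambda>\<pi>. smallest_part (k - 1) \<pi>"
  let ?w = "\<lambda>\<pi>. (?m \<pi>, {x \<in> \<pi>. x < ?m \<pi>}, {x \<in> \<pi>. x > ?m \<pi>})"
  let ?u = "\<lambda>(m, A, B). A \<union> insert m B"
  have T: "?u t \<in> ?P \<and> ?w (?u t) = t" if "t \<in> ?T" for t
  proof -
    obtain m A B where t: "t = (m, A, B)"
      by (cases t)
    have m: "m \<ge> k - 1" and A: "A \<subseteq> {1..m-1}" "card A = k - 2"
      and B: "B \<subseteq> {m+1..N}" "B \<noteq> {}"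
      using that t by auto
    have fin: "finite A" "finite B"
      using A B finite_subset by auto
    have "m \<le> N"
      using B by fastforce
    have less: "\<And>x. x \<in> A \<Longrightarrow> x < m" "\<And>x. x \<in> B \<Longrightarrow> m < x"
      using A B m assms(1) by fastforce+
    have "card B > 0"
      using fin B by (simp add: card_gt_0_iff)
    then have "k \<le> card (A \<union> insert m B)"
      using card_Un_insert_pivot[OF fin less] A assms(1) by simp
    moreover have "A \<union> insert m B \<subseteq> {1..N}"
      using A B m \<open>m \<le> N\<close> assms(1) by fastforce
    moreover have "{x \<in> A \<union> insert m B. x < m} = A" "{x \<in> A \<union> insert m B. x > m} = B"
      using less by fastforce+
    moreover have "?m (A \<union> insert m B) = m"
      using smallest_part_pivot[OF fin less] A assms(1)
      by (metis Suc_1 Suc_diff_Suc Suc_le_lessD)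
    ultimately show ?thesis
      using assms(1) t by simp
  qed
  have P: "?w \<pi> \<in> ?T \<and> ?u (?w \<pi>) = \<pi>" if "\<pi> \<in> ?P" for \<pi>
  proof -
    have \<pi>: "\<pi> \<subseteq> {1..N}" "k \<le> card \<pi>"
      using that by auto
    have fin: "finite \<pi>"
      using \<pi> finite_subset by auto
    note s = smallest_part_props[OF fin, of "k - 1"]
    have mem: "?m \<pi> \<in> \<pi>" and c: "card {x \<in> \<pi>. x < ?m \<pi>} = k - 2"
      using s assms(1) \<pi> by (auto simp: numeral_2_eq_2)
    have un: "{x \<in> \<pi>. x < ?m \<pi>} \<union> insert (?m \<pi>) {x \<in> \<pi>. x > ?m \<pi>} = \<pi>"
      using mem by auto
    have A: "{x \<in> \<pi>. x < ?m \<pi>} \<subseteq> {1..?m \<pi> - 1}"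
      using \<pi> by fastforce
    \<comment> \<open>The \<open>k - 2\<close> smaller parts are distinct and positive, which is why
      \<open>m\<close> starts at \<open>k - 1\<close>.\<close>
    then have "k - 2 \<le> ?m \<pi> - 1"
      using card_mono[OF _ A] c by simp
    moreover have "1 \<le> ?m \<pi>" "?m \<pi> \<le> N"
      using mem \<pi> by auto
    moreover have "{x \<in> \<pi>. x > ?m \<pi>} \<noteq> {}"
    proof
      assume "{x \<in> \<pi>. x > ?m \<pi>} = {}"
      then have "\<pi> = insert (?m \<pi>) {x \<in> \<pi>. x < ?m \<pi>}"
        using un by auto
      then have "card \<pi> \<le> Suc (k - 2)"
        using c by (metis (no_types, lifting) card_insert_if fin finite_insert le_refl less_irrefl mem_Collect_eq)
      then show False
        using \<pi> assms(1) by simp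
    qed
    moreover have "{x \<in> \<pi>. x > ?m \<pi>} \<subseteq> {?m \<pi> + 1..N}"
      using \<pi> by auto
    ultimately show ?thesis
      using A c un assms by auto
  qed
  have "?lhs = (\<Sum>t\<in>?T. f (?u t))"
    by (rule sum.reindex_bij_witness[OF conjunct2[OF P] conjunct1[OF P] conjunct2[OF T] conjunct1[OF T]])
      (assumption | rule arg_cong[of _ _ f, OF conjunct2[OF P]])+
  also have "\<dots> = (\<Sum>m=k-1..M. \<Sum>A\<in>?As m. \<Sum>B\<in>?Bs m. f (A \<union> insert m B))"
    using finA finB by (simp add: sum.Sigma sum.cartesian_product split_def)
  finally show ?thesis .
qed

section \<open>The signed sum over the upper parts\<close>

lemma fps_const_sum: "fps_const (sum f A) = (\<Sum>x\<in>A. fps_const (f x))"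
  by (induction A rule: infinite_finite_induct) (simp_all flip: fps_const_add)

text \<open>Expanding each product leaves the nonempty subsets of \<open>{n..N}\<close>. After
  exchanging the sums, a fixed \<open>B\<close> collects \<open>z ^ n\<close> for all
  \<open>n\<close> from \<open>m + 1\<close> up to \<open>Min B\<close>.\<close>

lemma sum_qprod_minus_one:
  fixes z :: complex
  shows "(\<Sum>n=m+1..N. fps_const (z ^ n) * ((\<Prod>i=n..N. 1 - fps_X ^ i) - 1)) =
    (\<Sum>B | B \<subseteq> {m+1..N} \<and> B \<noteq> {}.
       fps_const (\<Sum>n=m+1..Min B. z ^ n) * ((- 1) ^ card B * fps_X ^ \<Sum>B))"
proof -
  let ?g = "\<lambda>B :: nat set. (- 1) ^ card B * fps_X ^ \<Sum>B :: complex fps"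
  have fin: "finite {B. B \<subseteq> {n..N} \<and> B \<noteq> {}}" for n
    by (rule finite_subset[of _ "Pow {n..N}"]) auto
  have "(\<Prod>i=n..N. 1 - fps_X ^ i) - 1 = (\<Sum>B | B \<subseteq> {n..N} \<and> B \<noteq> {}. ?g B)" for n
  proof -
    have "Pow {n..N} = insert {} {B. B \<subseteq> {n..N} \<and> B \<noteq> {}}"
      by auto
    then show ?thesis
      using fin by (simp add: prod_one_minus_power)
  qed
  then have "(\<Sum>n=m+1..N. fps_const (z ^ n) * ((\<Prod>i=n..N. 1 - fps_X ^ i) - 1))
      = (\<Sum>n=m+1..N. \<Sum>B | B \<subseteq> {n..N} \<and> B \<noteq> {}. fps_const (z ^ n) * ?g B)"
    by (simp add: sum_distrib_left)
  \<comment> \<open>The range of \<open>B\<close> is made independent of \<open>n\<close> up to the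
    relation \<open>n \<le> Min B\<close>, the form needed for the exchange.\<close>
  also have "\<dots> = (\<Sum>n=m+1..N. \<Sum>B | (B \<subseteq> {m+1..N} \<and> B \<noteq> {}) \<and> n \<le> Min B. fps_const (z ^ n) * ?g B)"
  proof (intro sum.cong refl)
    fix n assume n: "n \<in> {m+1..N}"
    have "n \<le> Min B \<longleftrightarrow> B \<subseteq> {n..N}" if "B \<subseteq> {m+1..N}" "B \<noteq> {}" for B
    proof -
      have "finite B"
        using that finite_subset by auto
      with that show ?thesis
        by auto
    qed
    moreover have "{n..N} \<subseteq> {m+1..N}"
      using n by auto
    ultimately show "{B. B \<subseteq> {n..N} \<and> B \<noteq> {}} = {B. (B \<subseteq> {m+1..N} \<and> B \<noteq> {}) \<and> n \<le> Min B}"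
      by blast
  qed
  also have "\<dots> = (\<Sum>B | B \<subseteq> {m+1..N} \<and> B \<noteq> {}. \<Sum>n | n \<in> {m+1..N} \<and> n \<le> Min B. fps_const (z ^ n) * ?g B)"
    using sum.swap_restrict[OF _ fin[of "m+1"], where A = "{m+1..N}"
        and g = "\<lambda>n B. fps_const (z ^ n) * ?g B" and R = "\<lambda>n B. n \<le> Min B"]
    by simp
  also have "\<dots> = (\<Sum>B | B \<subseteq> {m+1..N} \<and> B \<noteq> {}. fps_const (\<Sum>n=m+1..Min B. z ^ n) * ?g B)"
  proof (intro sum.cong refl)
    fix B assume "B \<in> {B. B \<subseteq> {m+1..N} \<and> B \<noteq> {}}"
    then have B: "B \<subseteq> {m+1..N}" "B \<noteq> {}"
      by auto
    then have "Min B \<in> B"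
      by (intro Min_in) (auto intro: finite_subset)
    with B have "Min B \<le> N"
      by auto
    then have "{n. n \<in> {m+1..N} \<and> n \<le> Min B} = {m+1..Min B}"
      by auto
    then show "(\<Sum>n | n \<in> {m+1..N} \<and> n \<le> Min B. fps_const (z ^ n) * ?g B)
        = fps_const (\<Sum>n=m+1..Min B. z ^ n) * ?g B"
      by (simp add: sum_distrib_right[symmetric] fps_const_sum)
  qed
  finally show ?thesis .
qed

text \<open>Substitute \<open>n = i + (m + 1)\<close>. At \<open>M = m\<close> the identity would
  fail: the left sum is empty, while truncated subtraction leaves the term \<open>z ^ 0\<close> on
  the right.\<close>

lemma geometric_sum_shift:
  fixes z :: complex
  assumes "z \<noteq> 0" "m < M"
  shows "(1 / z) ^ Suc m * (\<Sum>n=m+1..M. z ^ n) = (\<Sum>i=0..M-m-1. z ^ i)"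
proof -
  have "(\<Sum>n=m+1..M. z ^ n) = (\<Sum>i=0..M-m-1. z ^ (i + (m + 1)))"
    using assms(2) sum.shift_bounds_cl_nat_ivl[of "\<lambda>i. z ^ i" 0 "m+1" "M-m-1"] by simp
  also have "\<dots> = z ^ Suc m * (\<Sum>i=0..M-m-1. z ^ i)"
    by (simp add: sum_distrib_left power_add mult_ac)
  finally show ?thesis
    using assms(1) by (simp add: power_one_over)
qed

section \<open>Comparison of the coefficients of \<open>q ^ N\<close>\<close>

theorem theorem4p1:
  fixes k :: nat and z :: complex
  assumes "k \<ge> 2" and "z \<noteq> 0"
  shows
    "Abs_fps (\<lambda>n. if n = 0 then 0 else
        (\<Sum>\<pi> | \<pi> \<in> distinct_partitions n \<and> card \<pi> \<ge> k.
          (- 1) ^ card \<pi> *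
          (\<Sum>i = 0..smallest_part k \<pi> - smallest_part (k - 1) \<pi> - 1. z ^ i)))
     = (- 1) ^ (k - 1) * (fps_const (1 / z) * fps_X ^ ((k - 1) * (k - 2) div 2)) *
       (\<Sum>i. let m = i + (k - 1) in
          (fps_const (1 / z) * fps_X) ^ m *
          (qbinom (m - 1) (k - 2) *
           (\<Sum>l. let n = l + (m + 1) in
              fps_const (z ^ n) * (qpoch_inf (fps_X ^ n) - 1))))"
    (is "_ = ?C * suminf ?f")
proof (rule fps_ext)
  fix N
  define w where
    "w \<pi> = (\<Sum>i = 0..smallest_part k \<pi> - smallest_part (k - 1) \<pi> - 1. z ^ i)" for \<pi>
  \<comment> \<open>The contribution of a single partition as a monomial, so that the power of
    \<open>q\<close> records its size.\<close>
  define h where "h \<pi> = (- 1) ^ card \<pi> * fps_const (w \<pi>) * fps_X ^ \<Sum>\<pi>" for \<pi>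
  define G where "G m = (\<Sum>n=m+1..N. fps_const (z ^ n) * ((\<Prod>i=n..N. 1 - fps_X ^ i) - 1))" for m
  define g where
    "g m = (fps_const (1 / z) * fps_X) ^ m * (qbinom (m - 1) (k - 2) * G m)" for m
  let ?As = "\<lambda>m. {A. A \<subseteq> {1..m-1} \<and> card A = k - 2}"
  let ?Bs = "\<lambda>m. {B. B \<subseteq> {m+1..N} \<and> B \<noteq> {}}"

  \<comment> \<open>Cutting at \<open>l \<le> N\<close> lets \<open>n\<close> run up to
    \<open>N + (m + 1)\<close>; the terms with \<open>n > N\<close> have an empty product, hence
    vanish, and \<open>G m\<close> remains.\<close>
  have F_nth: "(\<Sum>l. let n = l + (m + 1) in fps_const (z ^ n) * (qpoch_inf (fps_X ^ n) - 1)) $ j = G m $ j"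
    (is "suminf ?F $ j = _") if "j \<le> N" for m j
  proof -
    have "suminf ?F $ j = (\<Sum>l\<le>N. ?F l $ j)"
      using that by (intro fps_suminf_nth)
        (simp_all only: Let_def fps_mult_left_const_nth fps_sub_nth qpoch_inf_nth, simp)
    also have "\<dots> = (\<Sum>l\<le>N. (fps_const (z ^ (l + (m + 1))) * ((\<Prod>i=l + (m + 1)..N. 1 - fps_X ^ i) - 1)) $ j)"
      using that by (simp only: Let_def fps_mult_left_const_nth fps_sub_nth qpoch_inf_nth_eq_prod[OF le_add2[THEN order_trans[rotated]]])
    also have "\<dots> = (\<Sum>n=m+1..N+(m+1). (fps_const (z ^ n) * ((\<Prod>i=n..N. 1 - fps_X ^ i) - 1)) $ j)"
      by (simp only: atMost_atLeast0 sum.shift_bounds_cl_nat_ivl[where m = 0, unfolded add_0])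
    also have "\<dots> = G m $ j"
      unfolding G_def fps_sum_nth by (rule sum.mono_neutral_right) auto
    finally show ?thesis .
  qed

  \<comment> \<open>The factor \<open>q ^ m\<close> with \<open>m = i + (k - 1)\<close> removes all
    terms with \<open>i > j\<close>. In the others, only degrees of the inner sum up to
    \<open>N\<close> matter, so \<open>G m\<close> may replace it.\<close>
  have S_nth: "suminf ?f $ j = (\<Sum>m=k-1..N+(k-1). g m) $ j" if "j \<le> N" for j
  proof -
    have low: "?f i $ j = 0" if "j < i" for i j
    proof -
      have "(fps_const (1 / z) * fps_X) ^ m * H = fps_const (1 / z) ^ m * H * fps_X ^ m" for m H
        by (simp add: power_mult_distrib mult_ac)
      with that show ?thesis
        by (simp only: Let_def fps_X_power_nth_low)
    qed
    have "suminf ?f $ j = (\<Sum>i\<le>N. ?f i $ j)"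
      by (rule fps_suminf_nth[OF low that])
    also have "\<dots> = (\<Sum>i\<le>N. g (i + (k - 1)) $ j)"
      unfolding Let_def g_def
      by (intro sum.cong refl fps_mult_nth_cong) (use F_nth that in \<open>simp add: Let_def\<close>)
    also have "\<dots> = (\<Sum>m=k-1..N+(k-1). g m $ j)"
      by (simp only: atMost_atLeast0 sum.shift_bounds_cl_nat_ivl[where m = 0, unfolded add_0])
    finally show ?thesis
      by (simp add: fps_sum_nth)
  qed

  \<comment> \<open>The prefactor \<open>1 / z\<close> joins \<open>(1 / z) ^ m\<close> to give the
    power \<open>Suc m\<close> that \<open>geometric_sum_shift\<close> absorbs.\<close>
  have summand: "?C * g m = (\<Sum>A\<in>?As m. \<Sum>B\<in>?Bs m. h (A \<union> insert m B))" if m: "m \<ge> k - 1" for m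
  proof -
    let ?t = "(k - 1) * (k - 2) div 2"
    have t: "(k - 2) * (k - 2 + 1) div 2 = ?t"
    proof -
      have "k - 2 + 1 = k - 1"
        using assms(1) by simp
      then show ?thesis
        by (simp only: mult.commute)
    qed
    have "?C * g m = (- 1) ^ (k - 1) * fps_const (1 / z) ^ Suc m * fps_X ^ m *
        (fps_X ^ ?t * qbinom (m - 1) (k - 2)) * G m"
    proof -
      have "s * (c * x) * (p * y * (b * H)) = s * (c * p) * y * (x * b) * H"
        for s c x p y b H :: "complex fps"
        by (simp only: mult_ac)
      then show ?thesis
        unfolding g_def power_mult_distrib power_Suc .
    qed
    also have "\<dots> = (- 1) ^ (k - 1) * fps_const (1 / z) ^ Suc m * fps_X ^ m *
        (\<Sum>A\<in>?As m. fps_X ^ \<Sum>A) *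
        (\<Sum>B\<in>?Bs m. fps_const (\<Sum>n=m+1..Min B. z ^ n) * ((- 1) ^ card B * fps_X ^ \<Sum>B))"
      unfolding sum_power_subsets t G_def sum_qprod_minus_one ..
    also have "\<dots> = (\<Sum>A\<in>?As m. \<Sum>B\<in>?Bs m. (- 1) ^ (k - 1) * fps_const (1 / z) ^ Suc m * fps_X ^ m *
        fps_X ^ \<Sum>A * (fps_const (\<Sum>n=m+1..Min B. z ^ n) * ((- 1) ^ card B * fps_X ^ \<Sum>B)))"
      by (simp only: mult.assoc sum_product) (simp only: sum_distrib_left)
    also have "\<dots> = (\<Sum>A\<in>?As m. \<Sum>B\<in>?Bs m. h (A \<union> insert m B))"
    proof (intro sum.cong refl)
      fix A B assume "A \<in> ?As m" and "B \<in> ?Bs m"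
      then have A: "A \<subseteq> {1..m-1}" "card A = k - 2" and B: "B \<subseteq> {m+1..N}" "B \<noteq> {}"
        by auto
      have fin: "finite A" "finite B"
        using A B finite_subset by auto
      have less: "\<And>x. x \<in> A \<Longrightarrow> x < m" "\<And>x. x \<in> B \<Longrightarrow> m < x"
        using A B m assms(1) by fastforce+
      have k: "Suc (card A) = k - 1" "Suc (Suc (card A)) = k"
        using A assms(1) by auto
      have "m < Min B"
        using less(2) fin B by simp
      have "w (A \<union> insert m B) = (\<Sum>i=0..Min B - m - 1. z ^ i)"
        using smallest_part_pivot[OF fin less] smallest_part_after_pivot[OF fin less B(2)]
        unfolding k(2) unfolding k(1) w_def by simp
      also have "\<dots> = (1 / z) ^ Suc m * (\<Sum>n=m+1..Min B. z ^ n)"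
        using geometric_sum_shift[OF assms(2) \<open>m < Min B\<close>] by simp
      finally have w: "fps_const (w (A \<union> insert m B))
          = fps_const (1 / z) ^ Suc m * fps_const (\<Sum>n=m+1..Min B. z ^ n)"
        by (simp only: fps_const_power fps_const_mult)
      \<comment> \<open>The sign splits accordingly: \<open>A\<close> and \<open>m\<close> account
        for \<open>(- 1) ^ (k - 1)\<close>, and \<open>B\<close> for the rest.\<close>
      have "card (A \<union> insert m B) = (k - 1) + card B"
        using card_Un_insert_pivot[OF fin less] k by simp
      then show "(- 1) ^ (k - 1) * fps_const (1 / z) ^ Suc m * fps_X ^ m *
          fps_X ^ \<Sum>A * (fps_const (\<Sum>n=m+1..Min B. z ^ n) * ((- 1) ^ card B * fps_X ^ \<Sum>B))
          = h (A \<union> insert m B)"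
      proof -
        have "s * c * y * a * (p * (t * b)) = s * t * (c * p) * (a * y * b)"
          for s c y a p t b :: "complex fps"
          by (simp only: mult_ac)
        moreover have "h (A \<union> insert m B) = (- 1) ^ (k - 1) * (- 1) ^ card B *
            (fps_const (1 / z) ^ Suc m * fps_const (\<Sum>n=m+1..Min B. z ^ n)) *
            (fps_X ^ \<Sum>A * fps_X ^ m * fps_X ^ \<Sum>B)"
          using \<open>card (A \<union> insert m B) = _\<close> sum_Un_insert_pivot[OF fin less]
          unfolding h_def w by (simp only: power_add)
        ultimately show ?thesis
          by presburger
      qed
    qed
    finally show ?thesis .
  qed

  have partitions: "{\<pi>. (\<pi> \<subseteq> {1..N} \<and> k \<le> card \<pi>) \<and> \<Sum>\<pi> = N} = {\<pi>. \<pi> \<in> distinct_partitions N \<and> card \<pi> \<ge> k}"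
  proof -
    have "\<pi> \<subseteq> {1..N} \<longleftrightarrow> finite \<pi> \<and> 0 \<notin> \<pi>" if "\<Sum>\<pi> = N" "k \<le> card \<pi>" for \<pi> :: "nat set"
    proof
      assume \<pi>: "finite \<pi> \<and> 0 \<notin> \<pi>"
      show "\<pi> \<subseteq> {1..N}"
      proof
        fix x assume "x \<in> \<pi>"
        then have "x \<le> N" "x \<noteq> 0"
          using that(1) \<pi> member_le_sum[of x \<pi> "\<lambda>x. x"] by (auto intro: gr0I)
        then show "x \<in> {1..N}"
          by simp
      qed
    qed (auto intro: finite_subset)
    then show ?thesis
      unfolding distinct_partitions_def by auto
  qed
  have "(?C * suminf ?f) $ N = (?C * (\<Sum>m=k-1..N+(k-1). g m)) $ N"
    by (rule fps_mult_nth_cong) (rule S_nth)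
  also have "\<dots> = (\<Sum>m=k-1..N+(k-1). \<Sum>A\<in>?As m. \<Sum>B\<in>?Bs m. h (A \<union> insert m B)) $ N"
    unfolding sum_distrib_left using summand by simp
  also have "\<dots> = (\<Sum>\<pi> | \<pi> \<subseteq> {1..N} \<and> k \<le> card \<pi>. h \<pi>) $ N"
    using assms(1) by (subst sum_subsets_by_smallest_part[of k N "N + (k - 1)"]) simp_all
  also have "\<dots> = (\<Sum>\<pi> | \<pi> \<subseteq> {1..N} \<and> k \<le> card \<pi>. if \<Sum>\<pi> = N then (- 1) ^ card \<pi> * w \<pi> else 0)"
  proof -
    have "h \<pi> $ N = (if \<Sum>\<pi> = N then (- 1) ^ card \<pi> * w \<pi> else 0)" for \<pi>
    proof -
      have "h \<pi> = fps_const ((- 1) ^ card \<pi> * w \<pi>) * fps_X ^ \<Sum>\<pi>"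
        by (cases "even (card \<pi>)") (simp_all add: h_def)
      then show ?thesis
        by (simp add: fps_X_power_nth)
    qed
    then show ?thesis
      by (simp add: fps_sum_nth)
  qed
  also have "\<dots> = (\<Sum>\<pi> | (\<pi> \<subseteq> {1..N} \<and> k \<le> card \<pi>) \<and> \<Sum>\<pi> = N. (- 1) ^ card \<pi> * w \<pi>)"
    by (subst sum.inter_filter[symmetric]) (auto intro: finite_subset[of _ "Pow {1..N}"])
  also have "\<dots> = (\<Sum>\<pi> | \<pi> \<in> distinct_partitions N \<and> card \<pi> \<ge> k. (- 1) ^ card \<pi> * w \<pi>)"
    unfolding partitions ..
  \<comment> \<open>The only partition of 0 is empty and has fewer than \<open>k\<close> parts, so
    the prescribed constant term 0 is the right one.\<close>
  also have "\<dots> = (if N = 0 then 0 else \<Sum>\<pi> | \<pi> \<in> distinct_partitions N \<and> card \<pi> \<ge> k. (- 1) ^ card \<pi> * w \<pi>)"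
  proof (cases "N = 0")
    case True
    have "{\<pi>. \<pi> \<in> distinct_partitions 0 \<and> card \<pi> \<ge> k} = {}"
    proof -
      have "card \<pi> = 0" if "\<pi> \<in> distinct_partitions 0" for \<pi>
      proof -
        have "\<forall>x\<in>\<pi>. x = 0" and "0 \<notin> \<pi>"
          using that by (auto simp: distinct_partitions_def)
        then have "\<pi> = {}"
          by (metis equals0I)
        then show ?thesis
          by simp
      qed
      with assms(1) show ?thesis
        by force
    qed
    with True show ?thesis
      by (simp only: sum.empty if_True simp_thms)
  qed simp
  finally show "Abs_fps (\<lambda>n. if n = 0 then 0 else
        (\<Sum>\<pi> | \<pi> \<in> distinct_partitions n \<and> card \<pi> \<ge> k.
          (- 1) ^ card \<pi> *
          (\<Sum>i = 0..smallest_part k \<pi> - smallest_part (k - 1) \<pi> - 1. z ^ i))) $ N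
     = (?C * suminf ?f) $ N"
    unfolding w_def fps_nth_Abs_fps by (rule sym)
qed

end
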